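(* Let $\mathbf z^1$ be a design and $r\in T'$ a trip such that the rider of trip $r$ does not adopt the ODMTS under $\mathbf z^1$ and $LB\ge\alpha^rt^r_{cur}$, where $LB$ is the lower bound on trip duration defined in the context. Then the consistency cut for $r$ at $\mathbf z^1$ becomes the (valid) inequality $$\sum_{(h,l):z^1_{hl}=0}z_{hl}\ge\delta^r.$$
   Context: $N$ is a finite set of nodes, $H\subseteq N$ the set of hubs, $T'$ the set of trips with mode choice. Trip $r$ has distinct origin $or^r$ and destination $de^r$ in $N\setminus H$. For $i,j\in N$, $t_{ij}\ge0$ and $d_{ij}\ge0$ are travel time and distance (possibly asymmetric), each satisfying the triangle inequality. $\theta\in(0,1]$, $g\ge0$ is the shuttle cost per mile, $s\ge0$ the average bus waiting time. Put $\gamma^r_{ij}=(1-\theta)g\,d_{ij}+\theta t_{ij}$ and $\tau^r_{hl}=\theta(t_{hl}+s)$. A design is a $\mathbf z\in\{0,1\}^{|H|\times|H|}$ ($z_{hl}=1$ iff the bus leg from $h$ to $l$ is open); in the design problem it also satisfies weak connectivity $\sum_lz_{hl}=\sum_lz_{lh}$ for all $h\in H$. Given $\mathbf z$, the optimal route of $r$ is a solution of: lexicographically minimize $\langle b^r,f^r\rangle$ (first $b^r$, then $f^r$) over binary $x^r_{hl}$ ($h,l\in H$) and $y^r_{ij}$ ($(i,j)\in A^r$), with $b^r=\sum\tau^r_{hl}x^r_{hl}+\sum\gamma^r_{ij}y^r_{ij}$, $f^r=\sum(t_{hl}+s)x^r_{hl}+\sum t_{ij}y^r_{ij}$, subject to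 $x^r_{hl}\le z_{hl}$ and unit flow conservation from $or^r$ to $de^r$ over bus legs ($x$) and shuttle legs ($y$). Here $A^r=\{(or^r,h),(h,de^r):h\in H\}\cup\{(or^r,de^r)\}$. A route is either a direct shuttle ride from $or^r$ to $de^r$, or a shuttle from $or^r$ to a hub, bus leg(s), and a shuttle from a hub to $de^r$. The trip time is the lexicographically optimal $f^r$ (unique for given $\mathbf z$). With given positive $\alpha^r$, $t^r_{cur}$, the rider of $r$ adopts the system under $\mathbf z$ iff the trip time under $\mathbf z$ is at most $\alpha^rt^r_{cur}$; correspondingly, in the design problem $\delta^r\in\{0,1\}$ is constrained to equal $1$ iff the rider adopts under $\mathbf z$. An inequality in $(\mathbf z,\delta^r)$ is valid if every $(\mathbf z,\delta^r)$ feasible for the design problem satisfies it. Lower bound $LB$ at $\mathbf z^1$, with $t^1$ the trip time under $\mathbf z^1$: if the optimal route under $\mathbf z^1$ uses shuttles from $or^r$ to hub $m$ and from hub $n$ to $de^r$, $LB=t^1+\frac{1-\theta}{\theta}g\big(d_{or^rm}+d_{nde^r}-\max\{\max_{h,l\in H}\{d_{or^rh}+d_{lde^r}\},d_{or^rde^r}\}\big)$; if it is a direct shuttle trip, $LB=t^1$. The basic consistency cut being strengthened is $\sum_{(h,l):z^1_{hl}=0}z_{hl}+\sum_{(h,l):z^1_{hl}=1}(1-z_{hl})\ge\delta^r$. *)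

theory Defs
  imports Complex_Main
begin

record ('n, 'r) odmts_data =
  nodes :: "'n set"
  hubs :: "'n set"
  trips :: "'r set"
  orig :: "'r \<Rightarrow> 'n"
  dest :: "'r \<Rightarrow> 'n"
  ttime :: "'n \<Rightarrow> 'n \<Rightarrow> real"
  tdist :: "'n \<Rightarrow> 'n \<Rightarrow> real"
  theta :: real
  shuttle_cost :: real
  wait :: real
  alpha :: "'r \<Rightarrow> real"
  tcur :: "'r \<Rightarrow> real"

locale odmts =
  fixes I :: "('n, 'r) odmts_data"
  assumes finite_nodes: "finite (nodes I)"
    and hubs_nodes: "hubs I \<subseteq> nodes I"
    and orig_node: "r \<in> trips I \<Longrightarrow> orig I r \<in> nodes I - hubs I"
    and dest_node: "r \<in> trips I \<Longrightarrow> dest I r \<in> nodes I - hubs I"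
    and orig_neq_dest: "r \<in> trips I \<Longrightarrow> orig I r \<noteq> dest I r"
    and ttime_nonneg: "i \<in> nodes I \<Longrightarrow> j \<in> nodes I \<Longrightarrow> 0 \<le> ttime I i j"
    and tdist_nonneg: "i \<in> nodes I \<Longrightarrow> j \<in> nodes I \<Longrightarrow> 0 \<le> tdist I i j"
    and ttime_triangle: "i \<in> nodes I \<Longrightarrow> j \<in> nodes I \<Longrightarrow> k \<in> nodes I \<Longrightarrow>
      ttime I i k \<le> ttime I i j + ttime I j k"
    and tdist_triangle: "i \<in> nodes I \<Longrightarrow> j \<in> nodes I \<Longrightarrow> k \<in> nodes I \<Longrightarrow>
      tdist I i k \<le> tdist I i j + tdist I j k"
    and theta_pos: "0 < theta I"
    and theta_le_1: "theta I \<le> 1"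
    and shuttle_cost_nonneg: "0 \<le> shuttle_cost I"
    and wait_nonneg: "0 \<le> wait I"
    and alpha_pos: "r \<in> trips I \<Longrightarrow> 0 < alpha I r"
    and tcur_pos: "r \<in> trips I \<Longrightarrow> 0 < tcur I r"

text \<open>
  Binary variables are real-valued functions; only their values on the relevant index sets
  (\<open>hubs \<times> hubs\<close> for \<open>z\<close> and \<open>x\<close>, \<open>shuttle_arcs\<close> for \<open>y\<close>) are constrained or ever used.
\<close>

definition is_design :: "('n, 'r) odmts_data \<Rightarrow> ('n \<Rightarrow> 'n \<Rightarrow> real) \<Rightarrow> bool" where
  "is_design I z \<longleftrightarrow> (\<forall>h\<in>hubs I. \<forall>l\<in>hubs I. z h l \<in> {0, 1})"

definition weakly_connected :: "('n, 'r) odmts_data \<Rightarrow> ('n \<Rightarrow> 'n \<Rightarrow> real) \<Rightarrow> bool" where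
  "weakly_connected I z \<longleftrightarrow>
    (\<forall>h\<in>hubs I. (\<Sum>l\<in>hubs I. z h l) = (\<Sum>l\<in>hubs I. z l h))"

definition shuttle_weight :: "('n, 'r) odmts_data \<Rightarrow> 'n \<Rightarrow> 'n \<Rightarrow> real" where
  "shuttle_weight I i j =
    (1 - theta I) * shuttle_cost I * tdist I i j + theta I * ttime I i j"

definition bus_weight :: "('n, 'r) odmts_data \<Rightarrow> 'n \<Rightarrow> 'n \<Rightarrow> real" where
  "bus_weight I h l = theta I * (ttime I h l + wait I)"

definition shuttle_arcs :: "('n, 'r) odmts_data \<Rightarrow> 'r \<Rightarrow> ('n \<times> 'n) set" where
  "shuttle_arcs I r =
    {(orig I r, h) | h. h \<in> hubs I} \<union> {(h, dest I r) | h. h \<in> hubs I} \<union> {(orig I r, dest I r)}"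

definition route_feasible ::
  "('n, 'r) odmts_data \<Rightarrow> ('n \<Rightarrow> 'n \<Rightarrow> real) \<Rightarrow> 'r \<Rightarrow>
    ('n \<Rightarrow> 'n \<Rightarrow> real) \<Rightarrow> ('n \<Rightarrow> 'n \<Rightarrow> real) \<Rightarrow> bool" where
  "route_feasible I z r x y \<longleftrightarrow>
    (\<forall>h\<in>hubs I. \<forall>l\<in>hubs I. x h l \<in> {0, 1} \<and> x h l \<le> z h l) \<and>
    (\<forall>(i, j)\<in>shuttle_arcs I r. y i j \<in> {0, 1}) \<and>
    (\<forall>i\<in>nodes I.
      (if i \<in> hubs I then (\<Sum>l\<in>hubs I. x i l) - (\<Sum>l\<in>hubs I. x l i) else 0)
      + (\<Sum>j\<in>{j. (i, j) \<in> shuttle_arcs I r}. y i j)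
      - (\<Sum>j\<in>{j. (j, i) \<in> shuttle_arcs I r}. y j i)
      = (if i = orig I r then 1 else if i = dest I r then -1 else 0))"

definition route_cost ::
  "('n, 'r) odmts_data \<Rightarrow> 'r \<Rightarrow> ('n \<Rightarrow> 'n \<Rightarrow> real) \<Rightarrow> ('n \<Rightarrow> 'n \<Rightarrow> real) \<Rightarrow> real" where
  "route_cost I r x y =
    (\<Sum>h\<in>hubs I. \<Sum>l\<in>hubs I. bus_weight I h l * x h l)
    + (\<Sum>(i, j)\<in>shuttle_arcs I r. shuttle_weight I i j * y i j)"

definition route_time ::
  "('n, 'r) odmts_data \<Rightarrow> 'r \<Rightarrow> ('n \<Rightarrow> 'n \<Rightarrow> real) \<Rightarrow> ('n \<Rightarrow> 'n \<Rightarrow> real) \<Rightarrow> real" where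
  "route_time I r x y =
    (\<Sum>h\<in>hubs I. \<Sum>l\<in>hubs I. (ttime I h l + wait I) * x h l)
    + (\<Sum>(i, j)\<in>shuttle_arcs I r. ttime I i j * y i j)"

definition optimal_route ::
  "('n, 'r) odmts_data \<Rightarrow> ('n \<Rightarrow> 'n \<Rightarrow> real) \<Rightarrow> 'r \<Rightarrow>
    ('n \<Rightarrow> 'n \<Rightarrow> real) \<Rightarrow> ('n \<Rightarrow> 'n \<Rightarrow> real) \<Rightarrow> bool" where
  "optimal_route I z r x y \<longleftrightarrow>
    route_feasible I z r x y \<and>
    (\<forall>x' y'. route_feasible I z r x' y' \<longrightarrow>
      route_cost I r x y < route_cost I r x' y' \<or>
      route_cost I r x y = route_cost I r x' y' \<and> route_time I r x y \<le> route_time I r x' y')"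

text \<open>
  Optimal routes need not be unique, but their travel time is.
\<close>

definition trip_time :: "('n, 'r) odmts_data \<Rightarrow> ('n \<Rightarrow> 'n \<Rightarrow> real) \<Rightarrow> 'r \<Rightarrow> real" where
  "trip_time I z r = (THE f. \<exists>x y. optimal_route I z r x y \<and> f = route_time I r x y)"

definition adopts :: "('n, 'r) odmts_data \<Rightarrow> ('n \<Rightarrow> 'n \<Rightarrow> real) \<Rightarrow> 'r \<Rightarrow> bool" where
  "adopts I z r \<longleftrightarrow> trip_time I z r \<le> alpha I r * tcur I r"

definition design_feasible ::
  "('n, 'r) odmts_data \<Rightarrow> ('n \<Rightarrow> 'n \<Rightarrow> real) \<Rightarrow> ('r \<Rightarrow> real) \<Rightarrow> bool" where
  "design_feasible I z \<delta> \<longleftrightarrow>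
    is_design I z \<and> weakly_connected I z \<and>
    (\<forall>r\<in>trips I. \<delta> r \<in> {0, 1} \<and> (\<delta> r = 1 \<longleftrightarrow> adopts I z r))"

definition valid_inequality ::
  "('n, 'r) odmts_data \<Rightarrow> 'r \<Rightarrow> (('n \<Rightarrow> 'n \<Rightarrow> real) \<Rightarrow> real \<Rightarrow> bool) \<Rightarrow> bool" where
  "valid_inequality I r ineq \<longleftrightarrow> (\<forall>z \<delta>. design_feasible I z \<delta> \<longrightarrow> ineq z (\<delta> r))"

text \<open>
  For a feasible route, flow conservation at the origin and the destination makes exactly one
  shuttle arc leave the origin and exactly one enter the destination, so a route that is not
  direct has a unique first hub and a unique last hub.
\<close>

definition direct :: "('n, 'r) odmts_data \<Rightarrow> 'r \<Rightarrow> ('n \<Rightarrow> 'n \<Rightarrow> real) \<Rightarrow> bool" where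
  "direct I r y \<longleftrightarrow> y (orig I r) (dest I r) = 1"

definition first_hub :: "('n, 'r) odmts_data \<Rightarrow> 'r \<Rightarrow> ('n \<Rightarrow> 'n \<Rightarrow> real) \<Rightarrow> 'n" where
  "first_hub I r y = (THE m. m \<in> hubs I \<and> y (orig I r) m = 1)"

definition last_hub :: "('n, 'r) odmts_data \<Rightarrow> 'r \<Rightarrow> ('n \<Rightarrow> 'n \<Rightarrow> real) \<Rightarrow> 'n" where
  "last_hub I r y = (THE n. n \<in> hubs I \<and> y n (dest I r) = 1)"

text \<open>
  The lower bound for trip \<open>r\<close> at design \<open>z\<close>, where \<open>y\<close> are the shuttle legs of an optimal
  route under \<open>z\<close>.
\<close>

definition lower_bound ::
  "('n, 'r) odmts_data \<Rightarrow> ('n \<Rightarrow> 'n \<Rightarrow> real) \<Rightarrow> 'r \<Rightarrow> ('n \<Rightarrow> 'n \<Rightarrow> real) \<Rightarrow> real" where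
  "lower_bound I z r y =
    (if direct I r y then trip_time I z r
     else trip_time I z r + (1 - theta I) / theta I * shuttle_cost I *
       (tdist I (orig I r) (first_hub I r y) + tdist I (last_hub I r y) (dest I r)
        - max (Max {tdist I (orig I r) h + tdist I l (dest I r) | h l. h \<in> hubs I \<and> l \<in> hubs I})
              (tdist I (orig I r) (dest I r))))"

end

theory Submission
  imports Defs
begin

text \<open>
  If the claimed inequality failed, every bus leg open in \<open>z\<close> would be open in \<open>z1\<close>, so the routes
  under \<open>z\<close> are among those under \<open>z1\<close>. The cost decomposes as \<open>b = \<theta> f + (1 - \<theta>) g D\<close> with \<open>D\<close>
  the shuttle distance. Hence an optimal route under \<open>z\<close> that is strictly costlier than the one under
  \<open>z1\<close> takes longer than \<open>f1 + (1 - \<theta>) / \<theta> g (D1 - D)\<close>, which is at least the lower bound, while one of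
  equal cost takes at least \<open>f1\<close> by the lexicographic tie-break. A direct optimal route stays
  available under \<open>z\<close>, so in that case the costs are equal.
\<close>

section \<open>Selecting one binary variable, and lexicographic minima\<close>

lemma sum_binary_eq_1:
  fixes f :: "'a \<Rightarrow> real"
  assumes "finite A" "\<And>a. a \<in> A \<Longrightarrow> f a \<in> {0, 1}" "sum f A = 1"
  obtains a where "a \<in> A" "\<And>b. b \<in> A \<Longrightarrow> f b = of_bool (b = a)"
proof -
  obtain a where a: "a \<in> A" "f a \<noteq> 0"
    using assms(3) by (metis sum.neutral zero_neq_one)
  with assms(2) have "f a = 1" by blast
  then have "sum f (A - {a}) = 0"
    using sum.remove[OF assms(1) a(1), of f] assms(3) by simp
  moreover have "0 \<le> f b" if "b \<in> A - {a}" for b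
    using assms(2)[of b] that by auto
  ultimately have "\<forall>b\<in>A - {a}. f b = 0"
    using assms(1) by (subst (asm) sum_nonneg_eq_0_iff) auto
  with \<open>f a = 1\<close> a(1) show thesis by (intro that[of a]) auto
qed

text \<open>Finiteness is asked of the value pairs and not of \<open>A\<close>: feasible routes are
  functions unconstrained off their index sets, so there may be infinitely many of them.\<close>

lemma finite_lexicographic_minimum:
  fixes f g :: "'a \<Rightarrow> 'b::linorder"
  assumes "finite ((\<lambda>a. (f a, g a)) ` A)" "A \<noteq> {}"
  obtains a where "a \<in> A" "\<And>b. b \<in> A \<Longrightarrow> f a < f b \<or> f a = f b \<and> g a \<le> g b"
proof -
  have fin: "finite (f ` A)" "finite (g ` A)"
    using finite_imageI[OF assms(1), of fst] finite_imageI[OF assms(1), of snd]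
    by (simp_all add: image_image)
  define B where "B = {a \<in> A. f a = Min (f ` A)}"
  have "Min (f ` A) \<in> f ` A" using fin assms(2) by simp
  then have "B \<noteq> {}" by (auto simp: B_def)
  moreover have finB: "finite (g ` B)"
    using fin(2) by (rule finite_subset[rotated]) (auto simp: B_def)
  ultimately have "Min (g ` B) \<in> g ` B" by simp
  then obtain a where a: "a \<in> B" "g a = Min (g ` B)" by auto
  have "f a < f b \<or> f a = f b \<and> g a \<le> g b" if "b \<in> A" for b
  proof (cases "f b = Min (f ` A)")
    case True
    then have "b \<in> B" using that by (simp add: B_def)
    then show ?thesis using a finB True by (auto simp: B_def)
  next
    case False
    moreover have "Min (f ` A) \<le> f b" using fin that by simp
    ultimately show ?thesis using a by (auto simp: B_def)
  qed
  with a show thesis by (intro that[of a]) (auto simp: B_def)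
qed

section \<open>Trip time, monotonicity in the design, and cost split into time and shuttle
  distance\<close>

lemma trip_time_eq_route_time:
  assumes "optimal_route I z r x y"
  shows "trip_time I z r = route_time I r x y"
  unfolding trip_time_def
proof (rule the_equality)
  fix f assume "\<exists>x' y'. optimal_route I z r x' y' \<and> f = route_time I r x' y'"
  \<comment> \<open>Two optimal routes cannot each be strictly cheaper than the other, so their
    costs agree and each time bounds the other.\<close>
  then show "f = route_time I r x y"
    using assms unfolding optimal_route_def by fastforce
qed (use assms in blast)

lemma route_feasible_mono:
  assumes "route_feasible I z r x y"
    and "\<And>h l. h \<in> hubs I \<Longrightarrow> l \<in> hubs I \<Longrightarrow> z h l \<le> z' h l"
  shows "route_feasible I z' r x y"
proof -
  have "\<forall>h\<in>hubs I. \<forall>l\<in>hubs I. x h l \<in> {0, 1} \<and> x h l \<le> z' h l"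
    using assms unfolding route_feasible_def by (meson order_trans)
  then show ?thesis using assms(1) unfolding route_feasible_def by blast
qed

definition shuttle_distance :: "('n, 'r) odmts_data \<Rightarrow> 'r \<Rightarrow> ('n \<Rightarrow> 'n \<Rightarrow> real) \<Rightarrow> real" where
  "shuttle_distance I r y = (\<Sum>(i, j)\<in>shuttle_arcs I r. tdist I i j * y i j)"

text \<open>Every leg is charged \<open>theta\<close> times its time, waiting included; only shuttle
  legs carry a further charge, proportional to distance.\<close>

lemma route_cost_eq:
  "route_cost I r x y =
    theta I * route_time I r x y + (1 - theta I) * shuttle_cost I * shuttle_distance I r y"
  unfolding route_cost_def route_time_def shuttle_distance_def bus_weight_def shuttle_weight_def
  by (simp add: case_prod_unfold sum_distrib_left sum.distrib sum_subtractf algebra_simps)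

section \<open>The shuttle network of a single trip\<close>

locale odmts_trip = odmts I for I :: "('n, 'r) odmts_data" +
  fixes r :: 'r
  assumes trip: "r \<in> trips I"
begin

abbreviation src where "src \<equiv> orig I r"
abbreviation snk where "snk \<equiv> dest I r"

lemma finite_hubs [simp]: "finite (hubs I)"
  using finite_nodes hubs_nodes finite_subset by blast

lemma src_snk [simp]:
  "src \<in> nodes I" "snk \<in> nodes I" "src \<notin> hubs I" "snk \<notin> hubs I" "src \<noteq> snk" "snk \<noteq> src"
  using orig_node[OF trip] dest_node[OF trip] orig_neq_dest[OF trip] by auto

lemma shuttle_arcs_eq:
  "shuttle_arcs I r = Pair src ` hubs I \<union> (\<lambda>h. (h, snk)) ` hubs I \<union> {(src, snk)}"
  unfolding shuttle_arcs_def by auto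

lemma finite_shuttle_arcs [simp]: "finite (shuttle_arcs I r)"
  by (simp add: shuttle_arcs_eq)

text \<open>The three families of arcs are disjoint because neither endpoint of the trip is a hub,
  so no arc is counted twice.\<close>

lemma sum_shuttle_arcs:
  fixes F :: "'n \<Rightarrow> 'n \<Rightarrow> real"
  shows "(\<Sum>(i, j)\<in>shuttle_arcs I r. F i j) =
    (\<Sum>h\<in>hubs I. F src h) + (\<Sum>h\<in>hubs I. F h snk) + F src snk"
proof -
  have "(src, snk) \<notin> Pair src ` hubs I \<union> (\<lambda>h. (h, snk)) ` hubs I"
    "Pair src ` hubs I \<inter> (\<lambda>h. (h, snk)) ` hubs I = {}"
    using src_snk by (auto simp del: src_snk)
  then show ?thesis
    unfolding shuttle_arcs_eq
    by (simp add: sum.union_disjoint sum.reindex inj_on_def)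
qed

lemma shuttle_arcs_from:
  "{j. (i, j) \<in> shuttle_arcs I r} =
    (if i = src then insert snk (hubs I) else if i \<in> hubs I then {snk} else {})"
  unfolding shuttle_arcs_def using src_snk by (auto simp del: src_snk)

lemma shuttle_arcs_to:
  "{i. (i, j) \<in> shuttle_arcs I r} =
    (if j = snk then insert src (hubs I) else if j \<in> hubs I then {src} else {})"
  unfolding shuttle_arcs_def using src_snk by (auto simp del: src_snk)

section \<open>The direct ride and the existence of optimal routes\<close>

lemma direct_route_feasible:
  assumes "\<And>h l. h \<in> hubs I \<Longrightarrow> l \<in> hubs I \<Longrightarrow> 0 \<le> z h l"
  shows "route_feasible I z r (\<lambda>_ _. 0) (\<lambda>i j. of_bool (i = src \<and> j = snk))"
proof -
  let ?y = "\<lambda>i j. of_bool (i = src \<and> j = snk) :: real"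
  have "(\<Sum>j\<in>hubs I. ?y i j) = 0" "(\<Sum>j\<in>hubs I. ?y j i) = 0" for i
    using src_snk by (auto intro!: sum.neutral simp del: src_snk)
  then have "(\<Sum>j\<in>{j. (i, j) \<in> shuttle_arcs I r}. ?y i j) = of_bool (i = src)"
    "(\<Sum>j\<in>{j. (j, i) \<in> shuttle_arcs I r}. ?y j i) = of_bool (i = snk)" for i
    unfolding shuttle_arcs_from shuttle_arcs_to by simp_all
  then show ?thesis using assms by (simp add: route_feasible_def case_prod_unfold)
qed

lemma optimal_route_exists:
  assumes "\<And>h l. h \<in> hubs I \<Longrightarrow> l \<in> hubs I \<Longrightarrow> 0 \<le> z h l"
  obtains x y where "optimal_route I z r x y"
proof -
  define P where "P = {(x, y). route_feasible I z r x y}"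
  let ?val = "\<lambda>p. (route_cost I r (fst p) (snd p), route_time I r (fst p) (snd p))"
  \<comment> \<open>Cost and time depend only on which bus legs and shuttle arcs are used.
    \<open>?ind\<close> turns such a pair of sets into indicator functions, so the finite set
    \<open>?S\<close> produces every attainable value pair.\<close>
  let ?ind = "\<lambda>(X, Y). (\<lambda>i j. of_bool ((i, j) \<in> X), \<lambda>i j. of_bool ((i, j) \<in> Y))
    :: ('n \<Rightarrow> 'n \<Rightarrow> real) \<times> ('n \<Rightarrow> 'n \<Rightarrow> real)"
  let ?S = "Pow (hubs I \<times> hubs I) \<times> Pow (shuttle_arcs I r)"
  have "?val ` P \<subseteq> (?val \<circ> ?ind) ` ?S"
  proof
    fix v assume "v \<in> ?val ` P"
    then obtain x y where feas: "route_feasible I z r x y"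
      and v: "v = (route_cost I r x y, route_time I r x y)" by (auto simp: P_def)
    define X where "X = {(h, l). h \<in> hubs I \<and> l \<in> hubs I \<and> x h l = 1}"
    define Y where "Y = {(i, j). (i, j) \<in> shuttle_arcs I r \<and> y i j = 1}"
    have x: "x h l = of_bool ((h, l) \<in> X)" if "h \<in> hubs I" "l \<in> hubs I" for h l
      using feas that unfolding route_feasible_def X_def by auto
    have y: "y i j = of_bool ((i, j) \<in> Y)" if "(i, j) \<in> shuttle_arcs I r" for i j
      using feas that unfolding route_feasible_def Y_def by auto
    have "v = ?val (?ind (X, Y))"
      unfolding v route_cost_def route_time_def
      by (auto simp: x y intro!: arg_cong2[of _ _ _ _ "(+)"] sum.cong)
    moreover have "(X, Y) \<in> ?S" by (auto simp: X_def Y_def)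
    ultimately show "v \<in> (?val \<circ> ?ind) ` ?S" unfolding comp_def by (rule image_eqI)
  qed
  then have "finite (?val ` P)" by (rule finite_subset) simp
  \<comment> \<open>The direct ride uses no bus leg and is therefore available under every
    design.\<close>
  moreover have "P \<noteq> {}" using direct_route_feasible[of z] assms by (auto simp: P_def)
  ultimately obtain p where p: "p \<in> P" and min: "\<And>q. q \<in> P \<Longrightarrow>
      route_cost I r (fst p) (snd p) < route_cost I r (fst q) (snd q) \<or>
      route_cost I r (fst p) (snd p) = route_cost I r (fst q) (snd q) \<and>
      route_time I r (fst p) (snd p) \<le> route_time I r (fst q) (snd q)"
    using finite_lexicographic_minimum[where A = P and f = "\<lambda>p. route_cost I r (fst p) (snd p)"
        and g = "\<lambda>p. route_time I r (fst p) (snd p)"] by blast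
  have "optimal_route I z r (fst p) (snd p)"
    unfolding optimal_route_def
  proof (intro conjI allI impI)
    fix x y assume "route_feasible I z r x y"
    then show "route_cost I r (fst p) (snd p) < route_cost I r x y \<or>
      route_cost I r (fst p) (snd p) = route_cost I r x y \<and>
      route_time I r (fst p) (snd p) \<le> route_time I r x y"
      using min[of "(x, y)"] by (simp add: P_def)
  qed (use p in \<open>simp add: P_def case_prod_unfold\<close>)
  then show thesis by (rule that)
qed

section \<open>Shape of feasible routes and their shuttle distance\<close>

lemma route_cases [consumes 1, case_names direct hubs]:
  assumes "route_feasible I z r x y"
  obtains
    "y src snk = 1" "\<And>h. h \<in> hubs I \<Longrightarrow> y src h = 0" "\<And>h. h \<in> hubs I \<Longrightarrow> y h snk = 0"
  | m n where "y src snk = 0" "m \<in> hubs I" "n \<in> hubs I"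
      "\<And>h. h \<in> hubs I \<Longrightarrow> y src h = of_bool (h = m)"
      "\<And>h. h \<in> hubs I \<Longrightarrow> y h snk = of_bool (h = n)"
proof -
  have bal: "(if i \<in> hubs I then (\<Sum>l\<in>hubs I. x i l) - (\<Sum>l\<in>hubs I. x l i) else 0)
      + (\<Sum>j\<in>{j. (i, j) \<in> shuttle_arcs I r}. y i j)
      - (\<Sum>j\<in>{j. (j, i) \<in> shuttle_arcs I r}. y j i)
      = (if i = src then 1 else if i = snk then -1 else 0)" if "i \<in> nodes I" for i
    using assms that unfolding route_feasible_def by blast
  \<comment> \<open>No shuttle arc enters \<open>src\<close>, and no bus leg touches it, so flow
    balance there leaves an outflow of one, carried by a single binary arc. The argument at
    \<open>snk\<close> is symmetric.\<close>
  have "(\<Sum>j\<in>insert snk (hubs I). y src j) = 1"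
    using bal[of src] unfolding shuttle_arcs_from shuttle_arcs_to by simp
  moreover have "y src j \<in> {0, 1}" if "j \<in> insert snk (hubs I)" for j
    using assms that unfolding route_feasible_def shuttle_arcs_def by blast
  ultimately obtain m where m: "m \<in> insert snk (hubs I)"
    "\<And>h. h \<in> insert snk (hubs I) \<Longrightarrow> y src h = of_bool (h = m)"
    using sum_binary_eq_1[OF finite.insertI[OF finite_hubs]] by metis
  have "(\<Sum>j\<in>insert src (hubs I). y j snk) = 1"
    using bal[of snk] unfolding shuttle_arcs_from shuttle_arcs_to by simp
  moreover have "y j snk \<in> {0, 1}" if "j \<in> insert src (hubs I)" for j
    using assms that unfolding route_feasible_def shuttle_arcs_def by blast
  ultimately obtain n where n: "n \<in> insert src (hubs I)"
    "\<And>h. h \<in> insert src (hubs I) \<Longrightarrow> y h snk = of_bool (h = n)"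
    using sum_binary_eq_1[OF finite.insertI[OF finite_hubs]] by metis
  \<comment> \<open>Both sides say that the arc from \<open>src\<close> to \<open>snk\<close> is
    used, the one arc common to the two sums.\<close>
  have "m = snk \<longleftrightarrow> n = src" using m(2)[of snk] n(2)[of src] by auto
  show thesis
  proof (cases "m = snk")
    case True
    with \<open>m = snk \<longleftrightarrow> n = src\<close> m n show thesis by (intro that(1)) auto
  next
    case False
    with \<open>m = snk \<longleftrightarrow> n = src\<close> m n show thesis by (intro that(2)[of m n]) auto
  qed
qed

lemma shuttle_distance_direct:
  assumes "route_feasible I z r x y" "direct I r y"
  shows "shuttle_distance I r y = tdist I src snk"
  using assms(1)
  by (cases rule: route_cases)
    (use assms(2) in \<open>simp_all add: direct_def shuttle_distance_def sum_shuttle_arcs\<close>)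

text \<open>The uniqueness of \<open>m\<close> and \<open>n\<close> in \<open>route_cases\<close>
  makes both definite descriptions meaningful, which ties the distances in
  \<open>lower_bound\<close> to the shuttle distance of the route.\<close>

lemma first_last_hub:
  assumes "route_feasible I z r x y" "\<not> direct I r y"
  shows "first_hub I r y \<in> hubs I" "last_hub I r y \<in> hubs I"
    and "shuttle_distance I r y =
      tdist I src (first_hub I r y) + tdist I (last_hub I r y) snk"
proof -
  obtain m n where mn: "y src snk = 0" "m \<in> hubs I" "n \<in> hubs I"
    "\<And>h. h \<in> hubs I \<Longrightarrow> y src h = of_bool (h = m)"
    "\<And>h. h \<in> hubs I \<Longrightarrow> y h snk = of_bool (h = n)"
    using assms(1) by (cases rule: route_cases) (use assms(2) in \<open>auto simp: direct_def\<close>)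
  moreover have "first_hub I r y = m" "last_hub I r y = n"
    unfolding first_hub_def last_hub_def using mn by (auto intro!: the_equality)
  ultimately show "first_hub I r y \<in> hubs I" "last_hub I r y \<in> hubs I"
    "shuttle_distance I r y = tdist I src (first_hub I r y) + tdist I (last_hub I r y) snk"
    by (simp_all add: shuttle_distance_def sum_shuttle_arcs)
qed

text \<open>Each shape of route contributes one of the terms of the maximum. Without hubs the inner
  \<open>Max\<close> ranges over the empty set, but then every route is direct and the second
  argument of \<open>max\<close> gives the bound.\<close>

lemma shuttle_distance_le:
  assumes "route_feasible I z r x y"
  shows "shuttle_distance I r y \<le>
    max (Max {tdist I src h + tdist I l snk | h l. h \<in> hubs I \<and> l \<in> hubs I}) (tdist I src snk)"
proof (cases "direct I r y")
  case True
  then show ?thesis using shuttle_distance_direct[OF assms] by simp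
next
  case False
  have "{tdist I src h + tdist I l snk | h l. h \<in> hubs I \<and> l \<in> hubs I} =
      (\<lambda>(h, l). tdist I src h + tdist I l snk) ` (hubs I \<times> hubs I)" by auto
  then have "finite {tdist I src h + tdist I l snk | h l. h \<in> hubs I \<and> l \<in> hubs I}" by simp
  then show ?thesis using first_last_hub[OF assms False] by (auto intro!: max.coboundedI1 Max_ge)
qed

section \<open>Comparing optimal routes under two designs\<close>

lemma direct_route_optimal_le:
  assumes "\<And>h l. h \<in> hubs I \<Longrightarrow> l \<in> hubs I \<Longrightarrow> 0 \<le> z h l"
    and "optimal_route I z r x y"
    and "route_feasible I z1 r x1 y1" "direct I r y1"
  shows "route_cost I r x y \<le> route_cost I r x1 y1"
proof -
  let ?y = "\<lambda>i j. of_bool (i = src \<and> j = snk) :: real"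
  have "route_cost I r x y \<le> route_cost I r (\<lambda>_ _. 0) ?y"
    using assms(2) direct_route_feasible[of z] assms(1) unfolding optimal_route_def by force
  also have "\<dots> = shuttle_weight I src snk"
    by (auto simp: route_cost_def sum_shuttle_arcs intro!: sum.neutral)
  also have "\<dots> = (\<Sum>(i, j)\<in>shuttle_arcs I r. shuttle_weight I i j * y1 i j)"
    using assms(3)
    by (cases rule: route_cases) (use assms(4) in \<open>simp_all add: direct_def sum_shuttle_arcs\<close>)
  \<comment> \<open>Flow conservation still permits closed bus cycles in \<open>x1\<close> beside
    the direct ride; their weights are nonnegative.\<close>
  also have "\<dots> \<le> route_cost I r x1 y1"
  proof -
    have "0 \<le> bus_weight I h l * x1 h l" if "h \<in> hubs I" "l \<in> hubs I" for h l
    proof -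
      have "x1 h l \<in> {0, 1}" using assms(3) that unfolding route_feasible_def by blast
      then have "0 \<le> x1 h l" by auto
      moreover have "0 \<le> bus_weight I h l"
        unfolding bus_weight_def using theta_pos wait_nonneg ttime_nonneg[of h l] hubs_nodes that
        by (auto simp: subset_iff)
      ultimately show ?thesis by simp
    qed
    then show ?thesis unfolding route_cost_def by (simp add: sum_nonneg)
  qed
  finally show ?thesis .
qed

text \<open>Either alternative excludes adoption under \<open>z\<close> in the final argument: the
  first through non-adoption under \<open>z1\<close>, the second through the bound. The second is
  strict because the bound may equal the adoption threshold.\<close>

lemma fewer_legs_trip_time:
  assumes nonneg: "\<And>h l. h \<in> hubs I \<Longrightarrow> l \<in> hubs I \<Longrightarrow> 0 \<le> z h l"
    and le: "\<And>h l. h \<in> hubs I \<Longrightarrow> l \<in> hubs I \<Longrightarrow> z h l \<le> z1 h l"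
    and opt1: "optimal_route I z1 r x1 y1"
  shows "trip_time I z1 r \<le> trip_time I z r \<or> lower_bound I z1 r y1 < trip_time I z r"
proof -
  obtain x y where opt: "optimal_route I z r x y"
    using optimal_route_exists[of z] nonneg by blast
  then have feas: "route_feasible I z r x y" by (simp add: optimal_route_def)
  then have "route_feasible I z1 r x y" using le by (rule route_feasible_mono)
  with opt1 consider
      (tie) "route_time I r x1 y1 \<le> route_time I r x y"
    | (costlier) "route_cost I r x1 y1 < route_cost I r x y"
    unfolding optimal_route_def by blast
  then show ?thesis
  proof cases
    case tie
    then show ?thesis using trip_time_eq_route_time[OF opt] trip_time_eq_route_time[OF opt1] by simp
  next
    case costlier
    have feas1: "route_feasible I z1 r x1 y1" using opt1 by (simp add: optimal_route_def)
    \<comment> \<open>A direct ride stays available when legs close, so the optimum under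
      \<open>z\<close> could not cost more.\<close>
    have "\<not> direct I r y1"
      using direct_route_optimal_le[of z x y z1 x1 y1] nonneg opt feas1 costlier by force
    define D where
      "D = max (Max {tdist I src h + tdist I l snk | h l. h \<in> hubs I \<and> l \<in> hubs I})
        (tdist I src snk)"
    define c where "c = (1 - theta I) * shuttle_cost I"
    have "0 \<le> c" using theta_le_1 shuttle_cost_nonneg by (simp add: c_def)
    \<comment> \<open>The route under \<open>z\<close> is unknown, so its shuttle distance is
      replaced by the largest possible one; this is where the maximum in \<open>lower_bound\<close>
      comes from.\<close>
    then have "c * shuttle_distance I r y \<le> c * D"
      using shuttle_distance_le[OF feas] by (intro mult_left_mono) (simp_all add: D_def)
    with costlier have "theta I * route_time I r x1 y1 + c * (shuttle_distance I r y1 - D)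
        < theta I * route_time I r x y"
      unfolding route_cost_eq c_def[symmetric] by (simp add: algebra_simps)
    then have "route_time I r x1 y1 + c / theta I * (shuttle_distance I r y1 - D)
        < route_time I r x y"
      using theta_pos by (simp add: field_simps)
    moreover have "lower_bound I z1 r y1 =
        route_time I r x1 y1 + c / theta I * (shuttle_distance I r y1 - D)"
      using \<open>\<not> direct I r y1\<close> first_last_hub(3)[OF feas1] trip_time_eq_route_time[OF opt1]
      by (simp add: lower_bound_def D_def c_def)
    ultimately show ?thesis using trip_time_eq_route_time[OF opt] by simp
  qed
qed

end

section \<open>Validity of the strengthened cut\<close>

theorem proposition11:
  fixes I :: "('n, 'r) odmts_data"
    and r :: 'r
    and z1 x1 y1 :: "'n \<Rightarrow> 'n \<Rightarrow> real"
  assumes "odmts I"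
    and "r \<in> trips I"
    and "is_design I z1"
    and "optimal_route I z1 r x1 y1"
    and "\<not> adopts I z1 r"
    and "lower_bound I z1 r y1 \<ge> alpha I r * tcur I r"
  shows "valid_inequality I r
    (\<lambda>z \<delta>. (\<Sum>(h, l)\<in>{(h, l). h \<in> hubs I \<and> l \<in> hubs I \<and> z1 h l = 0}. z h l) \<ge> \<delta>)"
  unfolding valid_inequality_def
proof (intro allI impI)
  fix z \<delta> assume feas: "design_feasible I z \<delta>"
  interpret odmts_trip I r
    using assms(1,2) by (simp add: odmts_trip_def odmts_trip_axioms_def)
  let ?C = "{(h, l). h \<in> hubs I \<and> l \<in> hubs I \<and> z1 h l = 0}"
  have fin: "finite ?C" by (rule finite_subset[of _ "hubs I \<times> hubs I"]) auto
  have bin: "z h l \<in> {0, 1}" if "h \<in> hubs I" "l \<in> hubs I" for h l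
    using feas that by (auto simp: design_feasible_def is_design_def)
  have bin1: "z1 h l \<in> {0, 1}" if "h \<in> hubs I" "l \<in> hubs I" for h l
    using assms(3) that by (auto simp: is_design_def)
  have nonneg: "0 \<le> z h l" if "h \<in> hubs I" "l \<in> hubs I" for h l
    using bin[OF that] by auto
  have \<delta>: "\<delta> r \<in> {0, 1}" "\<delta> r = 1 \<longleftrightarrow> adopts I z r"
    using feas trip by (auto simp: design_feasible_def)
  have sum_nonneg: "0 \<le> (\<Sum>(h, l)\<in>?C. z h l)"
    using nonneg by (auto intro!: sum_nonneg)
  show "\<delta> r \<le> (\<Sum>(h, l)\<in>?C. z h l)"
  proof (rule ccontr)
    assume neg: "\<not> \<delta> r \<le> (\<Sum>(h, l)\<in>?C. z h l)"
    \<comment> \<open>A nonnegative sum can only fall below \<delta> if \<delta> is 1.\<close>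
    with \<delta> sum_nonneg have "adopts I z r" and small: "(\<Sum>(h, l)\<in>?C. z h l) < 1" by auto
    \<comment> \<open>A sum of binary values below 1 has no entry equal to 1, so \<open>z\<close>
      opens no leg that \<open>z1\<close> closes.\<close>
    have "z h l \<le> z1 h l" if hl: "h \<in> hubs I" "l \<in> hubs I" for h l
    proof (cases "z1 h l = 0")
      case True
      then have "(case (h, l) of (h, l) \<Rightarrow> z h l) \<le> (\<Sum>(h, l)\<in>?C. z h l)"
        using hl fin nonneg by (intro member_le_sum) auto
      with small bin[OF hl] True show ?thesis by auto
    next
      case False
      with bin[OF hl] bin1[OF hl] show ?thesis by auto
    qed
    with fewer_legs_trip_time[of z z1 x1 y1] nonneg assms(4)
    have "trip_time I z1 r \<le> trip_time I z r \<or> lower_bound I z1 r y1 < trip_time I z r"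
      by blast
    with \<open>adopts I z r\<close> assms(5,6) show False by (auto simp: adopts_def)
  qed
qed

end
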